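(* Let $A$ and $B$ be commutative rings and let $f\colon A\to B$ be an epimorphism of commutative rings that does not annihilate coprime ideals. Then the induced map $\operatorname{CoSp}(f)\colon \operatorname{CoSp}(A)\to \operatorname{CoSp}(B)$, $C\mapsto f(C)B$, is continuous.
   Context: All rings are commutative with identity. For ideals $I,J$ of a ring $A$, $\operatorname{Ann}(I)=\{a\in A\mid aI=0\}$ and $(J:I)=\{a\in A\mid aI\subseteq J\}$. The coproduct of $I$ and $J$ is the ideal $[I:J]:=(J:\operatorname{Ann}(I))=\{a\in A\mid a\operatorname{Ann}(I)\subseteq J\}$. An ideal $C$ of $A$ is coprime if $C\neq 0$ and, for all ideals $I,J$ of $A$, $C\subseteq [I:J]$ implies $C\subseteq I$ or $C\subseteq J$. $\operatorname{CoSp}(A)$ is the set of coprime ideals of $A$, regarded as a topological space whose closed sets are exactly the sets $V_c(I)=\{C\in\operatorname{CoSp}(A)\mid C\subseteq I\}$ for $I$ an ideal of $A$. An epimorphism of commutative rings is a ring morphism $f\colon A\to B$ such that for any two morphisms $g,h\colon B\to R$ of commutative rings, $g\circ f=h\circ f$ implies $g=h$ (it need not be surjective). For an ideal $C$ of $A$, $f(C)B$ denotes the ideal of $B$ generated by $f(C)$. An epimorphism $f\colon A\to B$ does not annihilate coprime ideals if for every $C\in\operatorname{CoSp}(A)$ the ideal $f(C)B$ is a non-zero proper ideal of $B$. For such $f$, the map $\operatorname{CoSp}(f)\colon \operatorname{CoSp}(A)\to\operatorname{CoSp}(B)$ is defined by $C\mapsto f(C)B$.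
   Formalization: The formal theorem additionally assumes that f(C)B is a coprime ideal of B for every coprime ideal C of A, i.e. that CoSp(f) really maps into CoSp(B); this does not follow from f being an epimorphism that does not annihilate coprime ideals. *)

theory Defs
  imports "HOL-Algebra.Algebra" "HOL-Analysis.Abstract_Topology"
begin

definition Ann :: "('a, 'm) ring_scheme \<Rightarrow> 'a set \<Rightarrow> 'a set" where
  "Ann A I = {a \<in> carrier A. \<forall>x\<in>I. a \<otimes>\<^bsub>A\<^esub> x = \<zero>\<^bsub>A\<^esub>}"

text \<open>\<open>colon A J I\<close> is the ideal quotient \<open>(J : I)\<close>.\<close>

definition colon :: "('a, 'm) ring_scheme \<Rightarrow> 'a set \<Rightarrow> 'a set \<Rightarrow> 'a set" where
  "colon A J I = {a \<in> carrier A. \<forall>x\<in>I. a \<otimes>\<^bsub>A\<^esub> x \<in> J}"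

text \<open>\<open>coproduct A I J\<close> is \<open>[I : J] = (J : Ann I)\<close>.\<close>

definition coproduct :: "('a, 'm) ring_scheme \<Rightarrow> 'a set \<Rightarrow> 'a set \<Rightarrow> 'a set" where
  "coproduct A I J = colon A J (Ann A I)"

definition coprime_ideal :: "('a, 'm) ring_scheme \<Rightarrow> 'a set \<Rightarrow> bool" where
  "coprime_ideal A C \<longleftrightarrow> ideal C A \<and> C \<noteq> {\<zero>\<^bsub>A\<^esub>} \<and>
     (\<forall>I J. ideal I A \<longrightarrow> ideal J A \<longrightarrow> C \<subseteq> coproduct A I J \<longrightarrow> C \<subseteq> I \<or> C \<subseteq> J)"

definition CoSp :: "('a, 'm) ring_scheme \<Rightarrow> 'a set set" where
  "CoSp A = {C. coprime_ideal A C}"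

definition V\<^sub>c :: "('a, 'm) ring_scheme \<Rightarrow> 'a set \<Rightarrow> 'a set set" where
  "V\<^sub>c A I = {C \<in> CoSp A. C \<subseteq> I}"

text \<open>
  \<open>CoSp_topology A\<close> is specified through its open sets.  The lemmas below show that, for a
  commutative ring, these do form a topology, that its space is \<open>CoSp A\<close>, and that its closed
  sets are exactly the sets \<open>V\<^sub>c A I\<close>.
\<close>

definition CoSp_topology :: "('a, 'm) ring_scheme \<Rightarrow> 'a set topology" where
  "CoSp_topology A = topology (\<lambda>U. \<exists>I. ideal I A \<and> U = CoSp A - V\<^sub>c A I)"

lemma (in cring) ideal_coproduct:
  assumes "ideal I R" "ideal J R"
  shows "ideal (coproduct R I J) R"
proof -
  interpret J: ideal J R by fact
  have sub: "Ann R I \<subseteq> carrier R" by (auto simp: Ann_def)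
  show ?thesis
  proof (rule idealI[OF ring_axioms])
    show "subgroup (coproduct R I J) (add_monoid R)"
    proof (rule add.subgroupI)
      show "coproduct R I J \<subseteq> carrier R" by (auto simp: coproduct_def colon_def)
      have "\<zero> \<in> coproduct R I J"
        using sub by (auto simp: coproduct_def colon_def subset_iff)
      then show "coproduct R I J \<noteq> {}" by blast
    next
      fix a assume "a \<in> coproduct R I J"
      then show "\<ominus> a \<in> coproduct R I J"
        using sub by (auto simp: coproduct_def colon_def l_minus subset_iff)
    next
      fix a b assume "a \<in> coproduct R I J" "b \<in> coproduct R I J"
      then show "a \<oplus> b \<in> coproduct R I J"
        using sub by (auto simp: coproduct_def colon_def l_distr subset_iff)
    qed
    fix a x assume a: "a \<in> coproduct R I J" and x: "x \<in> carrier R"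
    show 1: "x \<otimes> a \<in> coproduct R I J"
      using sub a x by (auto simp: coproduct_def colon_def m_assoc J.I_l_closed subset_iff)
    show "a \<otimes> x \<in> coproduct R I J"
      using 1 a x by (simp add: m_comm coproduct_def colon_def)
  qed
qed

lemma (in cring) V\<^sub>c_Un:
  assumes I: "ideal I R" and J: "ideal J R"
  shows "V\<^sub>c R I \<union> V\<^sub>c R J = V\<^sub>c R (coproduct R I J)"
proof -
  interpret I: ideal I R by fact
  interpret J: ideal J R by fact
  have "I \<subseteq> coproduct R I J"
  proof
    fix a assume a: "a \<in> I"
    then have "a \<in> carrier R" by (rule I.a_Hcarr)
    with a show "a \<in> coproduct R I J"
      by (auto simp: coproduct_def colon_def Ann_def m_comm)
  qed
  moreover have "J \<subseteq> coproduct R I J"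
    using J.a_Hcarr by (auto simp: coproduct_def colon_def Ann_def J.I_r_closed)
  moreover have "C \<subseteq> I \<or> C \<subseteq> J" if "C \<in> CoSp R" "C \<subseteq> coproduct R I J" for C
    using I J that unfolding CoSp_def coprime_ideal_def by blast
  ultimately show ?thesis
    unfolding V\<^sub>c_def by blast
qed

lemma (in cring) V\<^sub>c_Inter:
  assumes "\<I> \<noteq> {}" shows "(\<Inter>I\<in>\<I>. V\<^sub>c R I) = V\<^sub>c R (\<Inter>\<I>)"
  using assms by (auto simp: V\<^sub>c_def)

lemma (in cring) V\<^sub>c_carrier: "V\<^sub>c R (carrier R) = CoSp R"
proof -
  have "C \<subseteq> carrier R" if "C \<in> CoSp R" for C
    using that additive_subgroup.a_subset ideal.axioms(1)
    unfolding CoSp_def coprime_ideal_def by blast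
  then show ?thesis unfolding V\<^sub>c_def by blast
qed

lemma (in cring) V\<^sub>c_zero: "V\<^sub>c R {\<zero>} = {}"
proof -
  have "\<zero> \<in> C" "C \<noteq> {\<zero>}" if "C \<in> CoSp R" for C
    using that additive_subgroup.zero_closed ideal.axioms(1)
    unfolding CoSp_def coprime_ideal_def by blast+
  then show ?thesis unfolding V\<^sub>c_def by blast
qed

lemma (in cring) istopology_CoSp:
  "istopology (\<lambda>U. \<exists>I. ideal I R \<and> U = CoSp R - V\<^sub>c R I)"
  unfolding istopology_def
proof (intro conjI allI impI)
  fix S T
  assume "\<exists>I. ideal I R \<and> S = CoSp R - V\<^sub>c R I" "\<exists>I. ideal I R \<and> T = CoSp R - V\<^sub>c R I"
  then obtain I J where IJ: "ideal I R" "S = CoSp R - V\<^sub>c R I" "ideal J R" "T = CoSp R - V\<^sub>c R J"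
    by blast
  have "S \<inter> T = CoSp R - (V\<^sub>c R I \<union> V\<^sub>c R J)"
    using IJ(2,4) by blast
  then have "S \<inter> T = CoSp R - V\<^sub>c R (coproduct R I J)"
    by (simp only: V\<^sub>c_Un[OF IJ(1,3)])
  then show "\<exists>I. ideal I R \<and> S \<inter> T = CoSp R - V\<^sub>c R I"
    using ideal_coproduct[OF IJ(1,3)] by (intro exI conjI)
next
  fix \<K> assume *: "\<forall>K\<in>\<K>. \<exists>I. ideal I R \<and> K = CoSp R - V\<^sub>c R I"
  show "\<exists>I. ideal I R \<and> \<Union>\<K> = CoSp R - V\<^sub>c R I"
  proof (cases "\<K> = {}")
    case True
    then have "\<Union>\<K> = CoSp R - V\<^sub>c R (carrier R)" by (simp add: V\<^sub>c_carrier)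
    then show ?thesis using oneideal by (intro exI conjI)
  next
    case False
    from * obtain F where F: "\<And>K. K \<in> \<K> \<Longrightarrow> ideal (F K) R \<and> K = CoSp R - V\<^sub>c R (F K)"
      by metis
    have "\<Union>\<K> = (\<Union>K\<in>\<K>. CoSp R - V\<^sub>c R (F K))" using F by blast
    also have "\<dots> = CoSp R - (\<Inter>I\<in>F ` \<K>. V\<^sub>c R I)" using False by auto
    also have "\<dots> = CoSp R - V\<^sub>c R (\<Inter>(F ` \<K>))" using False by (subst V\<^sub>c_Inter) auto
    finally have "\<Union>\<K> = CoSp R - V\<^sub>c R (\<Inter>(F ` \<K>))" .
    moreover have "ideal (\<Inter>(F ` \<K>)) R" using False F by (intro i_Intersect) auto
    ultimately show ?thesis by (intro exI conjI)
  qed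
qed

lemma (in cring) openin_CoSp:
  "openin (CoSp_topology R) U \<longleftrightarrow> (\<exists>I. ideal I R \<and> U = CoSp R - V\<^sub>c R I)"
  unfolding CoSp_topology_def by (simp add: topology_inverse'[OF istopology_CoSp])

lemma (in cring) topspace_CoSp: "topspace (CoSp_topology R) = CoSp R"
proof
  show "topspace (CoSp_topology R) \<subseteq> CoSp R"
    using openin_topspace[of "CoSp_topology R"] unfolding openin_CoSp by blast
  have "openin (CoSp_topology R) (CoSp R)"
    unfolding openin_CoSp using zeroideal V\<^sub>c_zero by (intro exI[of _ "{\<zero>}"]) auto
  then show "CoSp R \<subseteq> topspace (CoSp_topology R)" by (rule openin_subset)
qed

lemma (in cring) closedin_CoSp:
  "closedin (CoSp_topology R) Z \<longleftrightarrow> (\<exists>I. ideal I R \<and> Z = V\<^sub>c R I)"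
proof -
  have "V\<^sub>c R I \<subseteq> CoSp R" for I by (auto simp: V\<^sub>c_def)
  then show ?thesis
    unfolding closedin_def openin_CoSp topspace_CoSp by (metis Diff_subset double_diff subset_refl)
qed

text \<open>
  Epimorphisms of commutative rings.  A definition in HOL cannot quantify over the carrier type of
  the test ring; the test rings here are those with carrier in \<open>('b \<times> 'b) list\<close>.  This is no
  restriction: the subring of \<open>R\<close> generated by the images of \<open>g\<close> and \<open>h\<close> consists of the finite
  sums of products \<open>g x \<otimes> h y\<close>, so it has a copy on that type.  Lemma \<open>ring_epi_cancel\<close>
  accordingly gives the cancellation property for test rings over an arbitrary type.
\<close>

definition ring_epi ::
    "('a, 'm) ring_scheme \<Rightarrow> ('b, 'n) ring_scheme \<Rightarrow> ('a \<Rightarrow> 'b) \<Rightarrow> bool" where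
  "ring_epi A B f \<longleftrightarrow> f \<in> ring_hom A B \<and>
     (\<forall>(R :: ('b \<times> 'b) list ring) g h.
        cring R \<longrightarrow> g \<in> ring_hom B R \<longrightarrow> h \<in> ring_hom B R \<longrightarrow>
        (\<forall>a\<in>carrier A. g (f a) = h (f a)) \<longrightarrow> (\<forall>b\<in>carrier B. g b = h b))"

primrec pair_sum ::
    "('r, 'k) ring_scheme \<Rightarrow> ('b \<Rightarrow> 'r) \<Rightarrow> ('b \<Rightarrow> 'r) \<Rightarrow> ('b \<times> 'b) list \<Rightarrow> 'r" where
  "pair_sum R g h [] = \<zero>\<^bsub>R\<^esub>"
| "pair_sum R g h (p # ps) = (g (fst p) \<otimes>\<^bsub>R\<^esub> h (snd p)) \<oplus>\<^bsub>R\<^esub> pair_sum R g h ps"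

lemma ring_epi_cancel:
  fixes R :: "('r, 'k) ring_scheme"
  assumes B: "cring B" and epi: "ring_epi A B f" and R: "cring R"
    and g: "g \<in> ring_hom B R" and h: "h \<in> ring_hom B R"
    and eq: "\<And>a. a \<in> carrier A \<Longrightarrow> g (f a) = h (f a)"
    and b: "b \<in> carrier B"
  shows "g b = h b"
proof -
  interpret B: cring B by fact
  interpret R: cring R by fact
  let ?L = "{ps. set ps \<subseteq> carrier B \<times> carrier B}"
  let ?ev = "pair_sum R g h"
  define K where "K = ?ev ` ?L"
  note gc = ring_hom_closed[OF g] and hc = ring_hom_closed[OF h]
  note gm = ring_hom_mult[OF g] and hm = ring_hom_mult[OF h]
  have ev_closed: "?ev ps \<in> carrier R" if "ps \<in> ?L" for ps
    using that by (induction ps) (auto simp: gc hc)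
  have ev_append: "?ev (ps @ qs) = ?ev ps \<oplus>\<^bsub>R\<^esub> ?ev qs" if "ps \<in> ?L" "qs \<in> ?L" for ps qs
    using that by (induction ps) (auto simp: gc hc R.a_assoc ev_closed)
  have add: "u \<oplus>\<^bsub>R\<^esub> v \<in> K" if "u \<in> K" "v \<in> K" for u v
  proof -
    from that obtain ps qs where *: "ps \<in> ?L" "u = ?ev ps" "qs \<in> ?L" "v = ?ev qs"
      unfolding K_def by blast
    then have "u \<oplus>\<^bsub>R\<^esub> v = ?ev (ps @ qs)" "ps @ qs \<in> ?L" by (simp_all add: ev_append)
    then show ?thesis unfolding K_def by blast
  qed
  have scale: "(g x \<otimes>\<^bsub>R\<^esub> h y) \<otimes>\<^bsub>R\<^esub> v \<in> K" if v: "v \<in> K" and x: "x \<in> carrier B"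
    and y: "y \<in> carrier B" for x y v
  proof -
    let ?t = "map (\<lambda>p. (x \<otimes>\<^bsub>B\<^esub> fst p, y \<otimes>\<^bsub>B\<^esub> snd p))"
    from v obtain qs where qs: "qs \<in> ?L" "v = ?ev qs" unfolding K_def by blast
    have "(g x \<otimes>\<^bsub>R\<^esub> h y) \<otimes>\<^bsub>R\<^esub> ?ev qs = ?ev (?t qs)"
      using qs(1) x y
      by (induction qs) (auto simp: gc hc gm hm R.r_distr ev_closed R.m_ac)
    moreover have "?t qs \<in> ?L" using qs(1) x y by auto
    ultimately show ?thesis using qs unfolding K_def by blast
  qed
  have pair: "g x \<otimes>\<^bsub>R\<^esub> h y \<in> K" if "x \<in> carrier B" "y \<in> carrier B" for x y
  proof -
    have "g x \<otimes>\<^bsub>R\<^esub> h y = ?ev [(x, y)]" using that by (simp add: gc hc)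
    moreover have "[(x, y)] \<in> ?L" using that by simp
    ultimately show ?thesis unfolding K_def by blast
  qed
  have gK: "g x \<in> K" if "x \<in> carrier B" for x
    using pair[OF that B.one_closed] that by (simp add: ring_hom_one[OF h] gc)
  have hK: "h x \<in> K" if "x \<in> carrier B" for x
    using pair[OF B.one_closed that] that by (simp add: ring_hom_one[OF g] hc)
  have KR: "K \<subseteq> carrier R" using ev_closed by (auto simp: K_def)
  have zero: "\<zero>\<^bsub>R\<^esub> \<in> K" unfolding K_def by (intro image_eqI[of _ _ "[]"]) auto
  have mult: "u \<otimes>\<^bsub>R\<^esub> v \<in> K" if "u \<in> K" "v \<in> K" for u v
  proof -
    from that obtain ps where ps: "ps \<in> ?L" "u = ?ev ps" unfolding K_def by blast
    have v: "v \<in> carrier R" using that KR by blast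
    have "?ev ps \<otimes>\<^bsub>R\<^esub> v \<in> K"
      using ps(1)
    proof (induction ps)
      case Nil
      then show ?case using v zero by simp
    next
      case (Cons p ps)
      then have "(g (fst p) \<otimes>\<^bsub>R\<^esub> h (snd p)) \<otimes>\<^bsub>R\<^esub> v \<in> K" "?ev ps \<otimes>\<^bsub>R\<^esub> v \<in> K"
        using scale \<open>v \<in> K\<close> by auto
      then show ?case using Cons.prems v by (auto simp: R.l_distr gc hc ev_closed add)
    qed
    then show ?thesis using ps by simp
  qed
  interpret gh: ring_hom_ring B R g
    using g by (intro ring_hom_ringI2) (auto intro: B.ring_axioms R.ring_axioms)
  have minus: "\<ominus>\<^bsub>R\<^esub> u \<in> K" if "u \<in> K" for u
  proof -
    have "\<ominus>\<^bsub>R\<^esub> \<one>\<^bsub>R\<^esub> \<in> K" using gK[of "\<ominus>\<^bsub>B\<^esub> \<one>\<^bsub>B\<^esub>"] by simp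
    from mult[OF this that] show ?thesis using that KR by (auto simp: R.l_minus subset_iff)
  qed
  have one: "\<one>\<^bsub>R\<^esub> \<in> K" using gK[of "\<one>\<^bsub>B\<^esub>"] by simp
  have "subring K R"
    using KR one minus mult add by (intro R.subringI) auto
  then have S: "cring (R\<lparr>carrier := K\<rparr>)"
    using R.subcring_iff[OF KR] R.subcringI' by blast
  interpret S: cring "R\<lparr>carrier := K\<rparr>" by (rule S)
  define \<phi> where "\<phi> u = (SOME ps. ps \<in> ?L \<and> ?ev ps = u)" for u
  have "?ev (\<phi> u) = u" if "u \<in> K" for u
    using that someI_ex[of "\<lambda>ps. ps \<in> ?L \<and> ?ev ps = u"] by (auto simp: K_def \<phi>_def)
  then have inj: "inj_on \<phi> K" by (rule inj_on_inverseI)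
  let ?T = "image_ring \<phi> (R\<lparr>carrier := K\<rparr>)"
  have iso: "\<phi> \<in> ring_iso (R\<lparr>carrier := K\<rparr>) ?T"
    by (rule inj_imp_image_ring_iso) (use inj in simp)
  have T: "cring ?T"
    using S.ring_iso_imp_img_cring[OF iso]
    by (simp add: image_ring_def image_group_def monoid.defs)
  have "g \<in> ring_hom B (R\<lparr>carrier := K\<rparr>)" "h \<in> ring_hom B (R\<lparr>carrier := K\<rparr>)"
    using g h gK hK by (auto simp: ring_hom_def Pi_def)
  then have "\<phi> \<circ> g \<in> ring_hom B ?T" "\<phi> \<circ> h \<in> ring_hom B ?T"
    using iso by (auto simp: ring_iso_def intro: ring_hom_trans)
  moreover have "\<forall>a\<in>carrier A. (\<phi> \<circ> g) (f a) = (\<phi> \<circ> h) (f a)" using eq by simp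
  ultimately have "(\<phi> \<circ> g) b = (\<phi> \<circ> h) b"
    using epi T b unfolding ring_epi_def by blast
  then show ?thesis using inj gK[OF b] hK[OF b] by (auto dest: inj_onD)
qed

definition not_annihilates_coprimes ::
    "('a, 'm) ring_scheme \<Rightarrow> ('b, 'n) ring_scheme \<Rightarrow> ('a \<Rightarrow> 'b) \<Rightarrow> bool" where
  "not_annihilates_coprimes A B f \<longleftrightarrow>
     (\<forall>C\<in>CoSp A. Idl\<^bsub>B\<^esub> (f ` C) \<noteq> {\<zero>\<^bsub>B\<^esub>} \<and> Idl\<^bsub>B\<^esub> (f ` C) \<noteq> carrier B)"

text \<open>
  \<open>CoSp_map B f\<close> sends \<open>C\<close> to \<open>f(C)B\<close>.  Being an epimorphism that does not annihilate coprime
  ideals does not force \<open>f(C)B\<close> to be coprime, so that this is a map from \<open>CoSp A\<close> to \<open>CoSp B\<close>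
  is a separate condition, \<open>CoSp_map B f \<in> CoSp A \<rightarrow> CoSp B\<close>.  For a prime \<open>p\<close>, let \<open>N\<close> be the
  Pruefer group of \<open>p\<close>, and let \<open>S\<close> be the ring of all \<open>(r, s)\<close> with \<open>r\<close> in the localization of the
  integers at \<open>p\<close> and \<open>s\<close> in the product of the prime fields of characteristic \<open>q \<noteq> p\<close>, where
  \<open>s q = r mod q\<close> for almost all \<open>q\<close>.  For the trivial extensions \<open>A\<close> of the integers by \<open>N\<close> and
  \<open>B\<close> of \<open>S\<close> by \<open>N\<close>, the coprime ideals of \<open>A\<close> are \<open>N\<close> and its subgroup of order \<open>p\<close>, and
  neither generates a coprime ideal of \<open>B\<close>.
\<close>

definition CoSp_map :: "('b, 'n) ring_scheme \<Rightarrow> ('a \<Rightarrow> 'b) \<Rightarrow> 'a set \<Rightarrow> 'b set" where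
  "CoSp_map B f C = Idl\<^bsub>B\<^esub> (f ` C)"

end

theory Submission
  imports Defs
begin

text \<open>Extension and contraction of ideals are adjoint: for an ideal J of B, f(C)B lies in J
  iff f(C) does, that is, iff C lies in the contraction of J along f. Hence the preimage of the
  closed set \<open>V\<^sub>c B J\<close> is \<open>V\<^sub>c A\<close> of that contraction, which
  is again an ideal.\<close>

theorem proposition16:
  fixes A :: "('a, 'm) ring_scheme" and B :: "('b, 'n) ring_scheme" and f :: "'a \<Rightarrow> 'b"
  assumes "cring A" and "cring B"
    and "ring_epi A B f"
    and "not_annihilates_coprimes A B f"
    and "CoSp_map B f \<in> CoSp A \<rightarrow> CoSp B"
  shows "continuous_map (CoSp_topology A) (CoSp_topology B) (CoSp_map B f)"
proof -
  interpret A: cring A by fact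
  interpret B: cring B by fact
  have "f \<in> ring_hom A B" using assms(3) by (simp add: ring_epi_def)
  then interpret f: ring_hom_ring A B f
    by (intro ring_hom_ringI2 A.ring_axioms B.ring_axioms)
  note to_CoSp = assms(5)
  have preimage: "{C \<in> CoSp A. CoSp_map B f C \<in> V\<^sub>c B J} = V\<^sub>c A {a \<in> carrier A. f a \<in> J}"
    if J: "ideal J B" for J
  proof -
    have "CoSp_map B f C \<in> V\<^sub>c B J \<longleftrightarrow> C \<subseteq> {a \<in> carrier A. f a \<in> J}" if C: "C \<in> CoSp A" for C
    proof -
      have CA: "C \<subseteq> carrier A"
        using C additive_subgroup.a_subset ideal.axioms(1)
        unfolding CoSp_def coprime_ideal_def by blast
      \<comment> \<open>f(C)B is the least ideal containing f(C), so containment in J can be tested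
        on generators.\<close>
      then have "Idl\<^bsub>B\<^esub> (f ` C) \<subseteq> J \<longleftrightarrow> f ` C \<subseteq> J"
        by (intro B.Idl_subset_ideal[OF J]) auto
      \<comment> \<open>Membership in \<open>V\<^sub>c B J\<close> also demands that f(C)B be
        coprime, which \<open>to_CoSp\<close> supplies.\<close>
      with CA C to_CoSp show ?thesis by (auto simp: V\<^sub>c_def CoSp_map_def)
    qed
    then show ?thesis by (auto simp: V\<^sub>c_def)
  qed
  show ?thesis
    \<comment> \<open>Closed sets are the natural test here, since each one is some
      \<open>V\<^sub>c B J\<close>.\<close>
    unfolding continuous_map_closedin A.topspace_CoSp B.topspace_CoSp A.closedin_CoSp B.closedin_CoSp
  proof (intro conjI allI impI)
    fix Z assume "\<exists>J. ideal J B \<and> Z = V\<^sub>c B J"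
    then show "\<exists>I. ideal I A \<and> {C \<in> CoSp A. CoSp_map B f C \<in> Z} = V\<^sub>c A I"
      using preimage f.ideal_vimage by blast
  qed (use to_CoSp in auto)
qed

end
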